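(* The book Ramsey number $R(B_8,B_{10})$ is equal to $37$.
   Context: All graphs are finite and simple. For graphs $G$ and $H$, the Ramsey number $R(G,H)$ is the smallest integer $n$ such that every graph on $n$ vertices contains $G$ as a subgraph (not necessarily induced) or its complement contains $H$ as a subgraph (not necessarily induced). For $t\ge 1$, the book graph $B_t$ is the graph consisting of $t$ triangles sharing a common edge; equivalently, $B_t$ is the graph on $t+2$ vertices obtained from an edge $uv$ by adding $t$ further vertices, each adjacent to both $u$ and $v$ (and with no other edges). *)

theory Defs
  imports "HOL-Library.Ramsey"
begin

type_synonym 'a graph = "'a set \<times> 'a set set"

abbreviation verts :: "'a graph \<Rightarrow> 'a set" where "verts \<equiv> fst"
abbreviation edges :: "'a graph \<Rightarrow> 'a set set" where "edges \<equiv> snd"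

definition simple_graph :: "'a graph \<Rightarrow> bool" where
  "simple_graph G \<longleftrightarrow> finite (verts G) \<and> edges G \<subseteq> nsets (verts G) 2"

definition graph_complement :: "'a graph \<Rightarrow> 'a graph" where
  "graph_complement G = (verts G, nsets (verts G) 2 - edges G)"

(* F contains a not necessarily induced subgraph isomorphic to G. *)
definition contains_copy :: "'a graph \<Rightarrow> 'b graph \<Rightarrow> bool" where
  "contains_copy F G \<longleftrightarrow>
     (\<exists>f. inj_on f (verts G) \<and> f ` verts G \<subseteq> verts F \<and> (\<forall>e\<in>edges G. f ` e \<in> edges F))"

(* Every finite graph is isomorphic to one with vertices in nat, so it suffices to range
   over graphs on sets of natural numbers. *)
definition ramsey_number :: "'a graph \<Rightarrow> 'b graph \<Rightarrow> nat" where
  "ramsey_number G H =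
     (LEAST n. \<forall>F :: nat graph. simple_graph F \<and> card (verts F) = n \<longrightarrow>
        contains_copy F G \<or> contains_copy (graph_complement F) H)"

(* The common edge is {0, 1}; the t further vertices are 2, ..., t + 1. *)
definition book_graph :: "nat \<Rightarrow> nat graph" where
  "book_graph t =
     ({..<t + 2}, {{0, 1}} \<union> (\<lambda>i. {0, i}) ` {2..<t + 2} \<union> (\<lambda>i. {1, i}) ` {2..<t + 2})"

end

theory Submission
  imports Defs "Jordan_Normal_Form.Schur_Decomposition"
begin

text \<open>
  In a graph with neither book, adjacent vertices have at most 7 common neighbours, and distinct
  non-adjacent vertices have at most 9 common non-neighbours.

  For the upper bound, suppose that such a graph has 37 vertices. Write $d(x)$ for the degree of $x$
  and $c(x,y)$ for the number of common neighbours. Then $c(x,y) \leq 7$ on adjacent pairs, and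
  inclusion-exclusion turns the second condition into $c(x,y) \leq d(x) + d(y) - 26$ on distinct
  non-adjacent pairs. Let $s(x,y) \geq 0$ be the slack in these inequalities. Since
  $\sum_{x,y} c(x,y) = \sum_z d(z)^2$, adding up all slacks gives
  $\sum_{x,y} s(x,y) = - \sum_x (d(x) - 18)(3 d(x) - 52)$. The product on the right is nonnegative at
  every integer and vanishes only at 18. Hence the graph is 18-regular and all slacks are 0: it is
  strongly regular with parameters $(37, 18, 7, 10)$ (\<open>no_37_vertex_graph_with_small_books\<close>).

  Such a graph does not exist (\<open>no_strongly_regular_37_18_7_10\<close>). Its adjacency matrix $M$
  satisfies $M^2 + 3M - 8I = 10J$, so every eigenvalue is 18 or one of $(-3 \pm \sqrt{41})/2$. The
  trace of $M$ is 0, and $\sqrt{41}$ is irrational, so the two irrational eigenvalues have the same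
  multiplicity; then 18 would have multiplicity $37/13$.

  For the lower bound it suffices to give one graph on 36 vertices without the two books, because
  its induced subgraphs then cover all smaller orders. The graph used here has two orbits of 18
  vertices under a cyclic group of rotations, so the codegrees have to be computed only for pairs
  that contain one of two base vertices.
\<close>

section \<open>The trace as a sum of eigenvalues\<close>

lemma trace_mult_commute:
  fixes A B :: "'a :: comm_semiring_0 mat"
  assumes A: "A \<in> carrier_mat n m" and B: "B \<in> carrier_mat m n"
  shows "(\<Sum>i<n. (A * B) $$ (i, i)) = (\<Sum>j<m. (B * A) $$ (j, j))"
proof -
  have "(\<Sum>i<n. (A * B) $$ (i, i)) = (\<Sum>i<n. \<Sum>j<m. A $$ (i, j) * B $$ (j, i))"
    using A B by (intro sum.cong) (auto simp: scalar_prod_def atLeast0LessThan intro!: sum.cong)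
  also have "\<dots> = (\<Sum>j<m. \<Sum>i<n. B $$ (j, i) * A $$ (i, j))"
    by (subst sum.swap) (simp add: mult.commute)
  also have "\<dots> = (\<Sum>j<m. (B * A) $$ (j, j))"
    using A B by (intro sum.cong) (auto simp: scalar_prod_def atLeast0LessThan intro!: sum.cong)
  finally show ?thesis .
qed

lemma trace_eq_sum_eigenvalues:
  fixes A :: "complex mat"
  assumes A: "A \<in> carrier_mat n n"
  shows "\<exists>es. length es = n \<and> (\<forall>e\<in>set es. eigenvalue A e) \<and> (\<Sum>i<n. A $$ (i, i)) = sum_list es"
proof -
  obtain es where cp: "char_poly A = (\<Prod>e\<leftarrow>es. [:- e, 1:])" and len: "length es = n"
    using char_poly_factorized[OF A] by blast
  obtain B P Q where schur: "schur_decomposition A es = (B, P, Q)"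
    by (cases "schur_decomposition A es") auto
  from schur_decomposition[OF A cp schur]
  have wit: "similar_mat_wit A B P Q" and diag: "diag_mat B = es" by auto
  note W = similar_mat_witD2[OF A wit]
  have "(\<Sum>i<n. A $$ (i, i)) = (\<Sum>i<n. (P * (B * Q)) $$ (i, i))"
    using W by (simp add: assoc_mult_mat[of P n n B n Q n])
  also have "\<dots> = (\<Sum>i<n. ((B * Q) * P) $$ (i, i))"
    by (rule trace_mult_commute) (use W in auto)
  also have "(B * Q) * P = B"
    using W by (simp add: assoc_mult_mat[of B n n Q n P n])
  also have "(\<Sum>i<n. B $$ (i, i)) = sum_list es"
    using W by (simp add: diag[symmetric] diag_mat_def sum_list_sum_nth atLeast0LessThan)
  finally have "(\<Sum>i<n. A $$ (i, i)) = sum_list es" .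
  moreover have "eigenvalue A e" if "e \<in> set es" for e
    unfolding eigenvalue_root_char_poly[OF A] cp
    using that by (simp add: poly_prod_list prod_list_zero_iff image_iff)
  ultimately show ?thesis using len by blast
qed

section \<open>Nonexistence of a strongly regular graph with parameters (37, 18, 7, 10)\<close>

text \<open>
  The hypotheses say that $A^2 = pA + qI + mJ$, where $J$ is the all-ones matrix, and that all
  column sums of $A$ are $k$. If $Av = ev$ and $s$ is the sum of the entries of $v$, then $es = ks$,
  and $s = 0$ makes the term $mJv$ vanish.
\<close>
lemma eigenvalue_of_quadratic_matrix:
  fixes A :: "complex mat"
  assumes A: "A \<in> carrier_mat n n"
    and col_sum: "\<And>j. j < n \<Longrightarrow> (\<Sum>i<n. A $$ (i, j)) = k"
    and square: "\<And>i j. i < n \<Longrightarrow> j < n \<Longrightarrow>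
      (\<Sum>l<n. A $$ (i, l) * A $$ (l, j)) = p * A $$ (i, j) + (if i = j then q else 0) + m"
    and e: "eigenvalue A e"
  shows "e = k \<or> e\<^sup>2 = p * e + q"
proof -
  obtain v where v: "v \<in> carrier_vec n" "v \<noteq> 0\<^sub>v n" "A *\<^sub>v v = e \<cdot>\<^sub>v v"
    using e A unfolding eigenvalue_def eigenvector_def by auto
  have Av: "(\<Sum>j<n. A $$ (i, j) * v $ j) = e * v $ i" if "i < n" for i
  proof -
    have "(A *\<^sub>v v) $ i = (\<Sum>j<n. A $$ (i, j) * v $ j)"
      using that A v(1) by (auto simp: scalar_prod_def atLeast0LessThan intro!: sum.cong)
    then show ?thesis using v that by simp
  qed
  define s where "s = (\<Sum>j<n. v $ j)"
  have "e * s = (\<Sum>i<n. \<Sum>j<n. A $$ (i, j) * v $ j)"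
    by (simp add: s_def sum_distrib_left Av)
  also have "\<dots> = (\<Sum>j<n. (\<Sum>i<n. A $$ (i, j)) * v $ j)"
    by (subst sum.swap) (simp add: sum_distrib_right)
  also have "\<dots> = k * s"
    by (simp add: col_sum s_def sum_distrib_left)
  finally have ks: "e = k \<or> s = 0" by auto
  have eq: "e\<^sup>2 * v $ i = p * (e * v $ i) + q * v $ i + m * s" if i: "i < n" for i
  proof -
    have "e\<^sup>2 * v $ i = (\<Sum>l<n. A $$ (i, l) * (e * v $ l))"
      using Av[OF i] by (simp add: power2_eq_square sum_distrib_left[symmetric] mult.left_commute)
    also have "\<dots> = (\<Sum>l<n. \<Sum>j<n. A $$ (i, l) * A $$ (l, j) * v $ j)"
      by (intro sum.cong) (auto simp: Av[symmetric] sum_distrib_left mult.assoc)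
    also have "\<dots> = (\<Sum>j<n. (\<Sum>l<n. A $$ (i, l) * A $$ (l, j)) * v $ j)"
      by (subst sum.swap) (simp add: sum_distrib_right)
    also have "\<dots> = (\<Sum>j<n. p * (A $$ (i, j) * v $ j) + (if i = j then q * v $ j else 0) + m * v $ j)"
    proof (rule sum.cong[OF refl])
      fix j assume "j \<in> {..<n}"
      then show "(\<Sum>l<n. A $$ (i, l) * A $$ (l, j)) * v $ j
          = p * (A $$ (i, j) * v $ j) + (if i = j then q * v $ j else 0) + m * v $ j"
        unfolding lessThan_iff by (subst square[OF i]) (auto simp: distrib_right mult.assoc)
    qed
    also have "\<dots> = p * (e * v $ i) + q * v $ i + m * s"
      using i by (simp add: sum.distrib sum_distrib_left[symmetric] Av s_def)
    finally show ?thesis .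
  qed
  obtain i where i: "i < n" "v $ i \<noteq> 0"
    using v(1,2) by (metis eq_vecI carrier_vecD index_zero_vec(1,2))
  show ?thesis
  proof (cases "s = 0")
    case True
    then have "(e\<^sup>2 - (p * e + q)) * v $ i = 0"
      using eq[OF i(1)] by (simp add: algebra_simps)
    then show ?thesis using i(2) by simp
  qed (use ks in simp)
qed

lemma prime_times_square_eq_square:
  fixes u w :: int
  assumes p: "prime p" and eq: "p * u\<^sup>2 = w\<^sup>2"
  shows "u = 0"
proof (rule ccontr)
  assume u: "u \<noteq> 0"
  have p0: "p \<noteq> 0" using p by auto
  with u eq have w: "w \<noteq> 0" by auto
  have "multiplicity p (p * u\<^sup>2) = multiplicity p p + multiplicity p (u\<^sup>2)"
    using p u p0 by (intro prime_elem_multiplicity_mult_distrib) auto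
  also have "\<dots> = 1 + 2 * multiplicity p u"
    using p u p0 not_prime_unit[of p] by (subst prime_elem_multiplicity_power_distrib) auto
  finally have "multiplicity p (p * u\<^sup>2) = 1 + 2 * multiplicity p u" .
  moreover have "multiplicity p (w\<^sup>2) = 2 * multiplicity p w"
    using p w by (subst prime_elem_multiplicity_power_distrib) auto
  ultimately show False unfolding eq by presburger
qed

lemma sum_list_three_values:
  fixes xs :: "'a :: comm_semiring_1 list"
  assumes "\<forall>x\<in>set xs. x = a \<or> x = b \<or> x = c"
  shows "\<exists>i j k. i + j + k = length xs \<and> sum_list xs = of_nat i * a + of_nat j * b + of_nat k * c"
  using assms
proof (induction xs)
  case (Cons x xs)
  then obtain i j k where ijk: "i + j + k = length xs"
    "sum_list xs = of_nat i * a + of_nat j * b + of_nat k * c" by auto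
  from Cons.prems consider "x = a" | "x = b" | "x = c" by auto
  then show ?case
  proof cases
    case 1 then show ?thesis using ijk
      by (intro exI[of _ "Suc i"] exI[of _ j] exI[of _ k]) (simp add: algebra_simps)
  next
    case 2 then show ?thesis using ijk
      by (intro exI[of _ i] exI[of _ "Suc j"] exI[of _ k]) (simp add: algebra_simps)
  next
    case 3 then show ?thesis using ijk
      by (intro exI[of _ i] exI[of _ j] exI[of _ "Suc k"]) (simp add: algebra_simps)
  qed
qed simp

text \<open>
  The graph is given by its adjacency matrix \<open>a\<close>, with entries 0 and 1. The codegree of distinct
  vertices is written uniformly as $10 - 3 a(x,y)$, which is 7 on edges and 10 on non-edges.
\<close>
lemma no_strongly_regular_37_18_7_10:
  fixes V :: "'a set" and a :: "'a \<Rightarrow> 'a \<Rightarrow> int"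
  assumes V: "card V = 37"
    and diag: "\<And>x. x \<in> V \<Longrightarrow> a x x = 0"
    and sym: "\<And>x y. x \<in> V \<Longrightarrow> y \<in> V \<Longrightarrow> a x y = a y x"
    and degree: "\<And>x. x \<in> V \<Longrightarrow> (\<Sum>y\<in>V. a x y) = 18"
    and codegree: "\<And>x y. x \<in> V \<Longrightarrow> y \<in> V \<Longrightarrow> x \<noteq> y \<Longrightarrow>
      (\<Sum>z\<in>V. a x z * a y z) = 10 - 3 * a x y"
    and square: "\<And>x y. x \<in> V \<Longrightarrow> y \<in> V \<Longrightarrow> a x y * a x y = a x y"
  shows False
proof -
  obtain h where h: "bij_betw h {..<37::nat} V"
    using V card_ge_0_finite[of V] by (metis bij_betw_iff_card card_lessThan finite_lessThan zero_less_numeral)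
  have hV: "h i \<in> V" if "i < 37" for i using h that by (auto simp: bij_betw_def)
  have h_inj: "h i = h j \<longleftrightarrow> i = j" if "i < 37" "j < 37" for i j
    using h that by (auto simp: bij_betw_def inj_on_def)
  have reindex: "(\<Sum>i<37. f (h i)) = (\<Sum>x\<in>V. f x)" for f :: "'a \<Rightarrow> int"
    by (rule sum.reindex_bij_betw[OF h])
  define M :: "complex mat" where "M = mat 37 37 (\<lambda>(i, j). of_int (a (h i) (h j)))"
  have M: "M \<in> carrier_mat 37 37" by (simp add: M_def)
  have M_idx: "M $$ (i, j) = of_int (a (h i) (h j))" if "i < 37" "j < 37" for i j
    using that by (simp add: M_def)
  have col_sum: "(\<Sum>i<37. M $$ (i, j)) = 18" if "j < 37" for j
  proof -
    have "(\<Sum>i<37. M $$ (i, j)) = of_int (\<Sum>i<37. a (h j) (h i))"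
      using that by (simp add: M_idx sym[OF hV[OF that] hV])
    then show ?thesis unfolding reindex by (simp only: degree[OF hV[OF that]] of_int_numeral)
  qed
  have M_square: "(\<Sum>l<37. M $$ (i, l) * M $$ (l, j)) = - 3 * M $$ (i, j) + (if i = j then 8 else 0) + 10"
    if ij: "i < 37" "j < 37" for i j
  proof -
    have "(\<Sum>l<37. M $$ (i, l) * M $$ (l, j)) = of_int (\<Sum>l<37. a (h i) (h l) * a (h j) (h l))"
      using ij by (simp add: M_idx sym[OF hV[OF ij(2)] hV])
    also have "(\<Sum>l<37. a (h i) (h l) * a (h j) (h l)) = (\<Sum>z\<in>V. a (h i) z * a (h j) z)"
      by (rule reindex)
    also have "\<dots> = - 3 * a (h i) (h j) + (if i = j then 8 else 0) + 10"
    proof (cases "i = j")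
      case True
      have "(\<Sum>z\<in>V. a (h i) z * a (h i) z) = (\<Sum>z\<in>V. a (h i) z)"
        by (intro sum.cong) (simp_all add: square hV ij)
      then show ?thesis using True by (simp add: degree diag hV ij)
    qed (simp add: codegree hV h_inj ij)
    finally show ?thesis using ij by (simp add: M_idx)
  qed
  obtain es where es: "length es = 37" "\<forall>e\<in>set es. eigenvalue M e"
      "(\<Sum>i<37. M $$ (i, i)) = sum_list es"
    using trace_eq_sum_eigenvalues[OF M] by blast
  define r :: complex where "r = of_real (sqrt 41)"
  have r2: "r\<^sup>2 = 41" unfolding r_def of_real_power[symmetric] by simp
  have "e = 18 \<or> e = (- 3 + r) / 2 \<or> e = (- 3 - r) / 2" if "e \<in> set es" for e
  proof -
    have "e = 18 \<or> e\<^sup>2 = - 3 * e + 8"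
      by (rule eigenvalue_of_quadratic_matrix[OF M col_sum M_square]) (use es that in auto)
    moreover have "(2 * e + 3 - r) * (2 * e + 3 + r) = 4 * (e\<^sup>2 + 3 * e - 8) + (41 - r\<^sup>2)"
      by (simp add: algebra_simps power2_eq_square)
    ultimately have "e = 18 \<or> 2 * e + 3 - r = 0 \<or> 2 * e + 3 + r = 0"
      using r2 by auto
    then show ?thesis
    proof (elim disjE)
      assume "2 * e + 3 - r = 0"
      then have "r = 2 * e + 3" by (simp add: algebra_simps)
      then show ?thesis by simp
    next
      assume "2 * e + 3 + r = 0"
      then have "r = - (2 * e + 3)" by (metis add.commute eq_neg_iff_add_eq_0)
      then show ?thesis by simp
    qed simp
  qed
  then obtain i j k where ijk: "i + j + k = 37"
    "sum_list es = of_nat i * 18 + of_nat j * ((- 3 + r) / 2) + of_nat k * ((- 3 - r) / 2)"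
    using sum_list_three_values[of es 18 "(- 3 + r) / 2" "(- 3 - r) / 2"] es(1) by auto
  have "sum_list es = 0"
    unfolding es(3)[symmetric] by (simp add: M_idx diag hV)
  moreover have "of_int (int j - int k) * r - of_int (3 * (int j + int k) - 36 * int i) = 2 * sum_list es"
    unfolding ijk(2) by (simp add: field_simps)
  ultimately have "of_int (int j - int k) * r = of_int (3 * (int j + int k) - 36 * int i)"
    by simp
  \<comment> \<open>Squaring replaces \<open>r\<close> by 41 and leaves an equation between integers.\<close>
  then have "(of_int (int j - int k) * r)\<^sup>2 = (of_int (3 * (int j + int k) - 36 * int i))\<^sup>2"
    by simp
  then have "(of_int (41 * (int j - int k)\<^sup>2) :: complex) = of_int ((3 * (int j + int k) - 36 * int i)\<^sup>2)"
    by (simp only: power_mult_distrib r2 of_int_mult of_int_power of_int_numeral mult.commute)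
  then have eq: "41 * (int j - int k)\<^sup>2 = (3 * (int j + int k) - 36 * int i)\<^sup>2"
    by (simp only: of_int_eq_iff)
  have "int j - int k = 0"
    by (rule prime_times_square_eq_square[OF _ eq]) simp
  with eq have "3 * (int j + int k) = 36 * int i" by simp
  with ijk(1) show False by presburger
qed


section \<open>The upper bound by counting codegrees\<close>

lemma no_37_vertex_graph_with_small_books:
  fixes V :: "'a set" and A :: "'a \<Rightarrow> 'a \<Rightarrow> bool"
  assumes V: "card V = 37"
    and irrefl: "\<And>x. x \<in> V \<Longrightarrow> \<not> A x x"
    and sym: "\<And>x y. x \<in> V \<Longrightarrow> y \<in> V \<Longrightarrow> A x y \<Longrightarrow> A y x"
    and adj: "\<And>x y. x \<in> V \<Longrightarrow> y \<in> V \<Longrightarrow> A x y \<Longrightarrow> card {z\<in>V. A x z \<and> A y z} \<le> 7"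
    and non_adj: "\<And>x y. x \<in> V \<Longrightarrow> y \<in> V \<Longrightarrow> x \<noteq> y \<Longrightarrow> \<not> A x y \<Longrightarrow>
      card {z\<in>V. z \<noteq> x \<and> z \<noteq> y \<and> \<not> A x z \<and> \<not> A y z} \<le> 9"
  shows False
proof -
  have fin: "finite V" using V by (metis card.infinite zero_neq_numeral)
  define a :: "'a \<Rightarrow> 'a \<Rightarrow> int" where "a x y = of_bool (A x y)" for x y
  define d where "d x = (\<Sum>y\<in>V. a x y)" for x
  define c where "c x y = (\<Sum>z\<in>V. a x z * a y z)" for x y
  define b :: "'a \<Rightarrow> 'a \<Rightarrow> int" where "b x y = of_bool (x \<noteq> y) - a x y" for x y
  have a_sym: "a x y = a y x" if "x \<in> V" "y \<in> V" for x y
    using that sym by (auto simp: a_def)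
  have b_sym: "b x y = b y x" if "x \<in> V" "y \<in> V" for x y
    using a_sym[OF that] by (auto simp: b_def)
  have a_diag: "a x x = 0" if "x \<in> V" for x using that irrefl by (simp add: a_def)
  have c_diag: "c x x = d x" for x by (auto simp: c_def d_def a_def intro!: sum.cong)
  have sum_b: "(\<Sum>y\<in>V. b x y) = 36 - d x" if "x \<in> V" for x
  proof -
    have "(\<Sum>y\<in>V. of_bool (x \<noteq> y) :: int) = (\<Sum>y\<in>V. 1 - (if y = x then 1 else 0))"
      by (intro sum.cong) auto
    also have "\<dots> = 36"
      using that fin V by (simp add: sum_subtractf)
    finally show ?thesis by (simp add: b_def d_def sum_subtractf)
  qed
  \<comment> \<open>The slack of the codegree bounds; the terms for \<open>x = y\<close> are chosen so that \<open>s x x = 0\<close>.\<close>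
  define s where "s x y = 7 * a x y + b x y * (d x + d y - 26) - c x y + (if x = y then d x else 0)" for x y
  have s_nonneg: "s x y \<ge> 0" if xy: "x \<in> V" "y \<in> V" for x y
  proof -
    consider "x = y" | "x \<noteq> y" "A x y" | "x \<noteq> y" "\<not> A x y" by auto
    then show ?thesis
    proof cases
      case 1
      then show ?thesis using xy by (simp add: s_def b_def a_diag c_diag)
    next
      case 2
      have "c x y = (\<Sum>z\<in>V. of_bool (A x z \<and> A y z))"
        unfolding c_def by (intro sum.cong) (auto simp: a_def)
      also have "\<dots> = int (card {z\<in>V. A x z \<and> A y z})"
        using fin by (simp add: Int_def)
      finally show ?thesis using 2 adj[OF xy] by (simp add: s_def b_def a_def)
    next
      case 3
      have "int (card {z\<in>V. z \<noteq> x \<and> z \<noteq> y \<and> \<not> A x z \<and> \<not> A y z})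
          = (\<Sum>z\<in>V. of_bool (z \<noteq> x \<and> z \<noteq> y \<and> \<not> A x z \<and> \<not> A y z))"
        using fin by (simp add: Int_def)
      also have "\<dots> = (\<Sum>z\<in>V. 1 - a x z - a y z + a x z * a y z
          - (if z = x then 1 else 0) - (if z = y then 1 else 0))"
        using 3 xy sym[of x y] sym[of y x] irrefl by (intro sum.cong) (auto simp: a_def)
      also have "\<dots> = 35 - d x - d y + c x y"
        using fin xy V by (simp add: sum.distrib sum_subtractf d_def c_def)
      finally show ?thesis using 3 non_adj[OF xy] by (simp add: s_def b_def a_def)
    qed
  qed
  have sum_c: "(\<Sum>x\<in>V. \<Sum>y\<in>V. c x y) = (\<Sum>z\<in>V. d z * d z)"
  proof -
    have "(\<Sum>x\<in>V. \<Sum>y\<in>V. c x y) = (\<Sum>x\<in>V. \<Sum>z\<in>V. \<Sum>y\<in>V. a x z * a y z)"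
      unfolding c_def by (intro sum.cong refl sum.swap)
    also have "\<dots> = (\<Sum>z\<in>V. \<Sum>x\<in>V. \<Sum>y\<in>V. a x z * a y z)"
      by (rule sum.swap)
    also have "\<dots> = (\<Sum>z\<in>V. (\<Sum>x\<in>V. a x z) * (\<Sum>y\<in>V. a y z))"
      by (simp add: sum_product)
    also have "\<dots> = (\<Sum>z\<in>V. d z * d z)"
      by (intro sum.cong) (simp_all add: d_def a_sym cong: sum.cong)
    finally show ?thesis .
  qed
  have sum_bd: "(\<Sum>x\<in>V. \<Sum>y\<in>V. b x y * (d x + d y - 26)) = (\<Sum>x\<in>V. (36 - d x) * (2 * d x - 26))"
  proof -
    have "(\<Sum>x\<in>V. \<Sum>y\<in>V. b x y * (d x + d y - 26))
        = (\<Sum>x\<in>V. \<Sum>y\<in>V. b x y * (d x - 26)) + (\<Sum>x\<in>V. \<Sum>y\<in>V. b x y * d y)"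
      by (simp add: sum.distrib[symmetric] algebra_simps)
    also have "(\<Sum>x\<in>V. \<Sum>y\<in>V. b x y * d y) = (\<Sum>y\<in>V. \<Sum>x\<in>V. b y x * d y)"
      by (subst sum.swap) (intro sum.cong, simp_all add: b_sym)
    also have "(\<Sum>x\<in>V. \<Sum>y\<in>V. b x y * (d x - 26)) + (\<Sum>y\<in>V. \<Sum>x\<in>V. b y x * d y)
        = (\<Sum>x\<in>V. (36 - d x) * (d x - 26) + (36 - d x) * d x)"
      unfolding sum.distrib by (simp only: sum_distrib_right[symmetric] sum_b cong: sum.cong)
    also have "\<dots> = (\<Sum>x\<in>V. (36 - d x) * (2 * d x - 26))"
      by (intro sum.cong) (auto simp: algebra_simps)
    finally show ?thesis .
  qed
  have total: "(\<Sum>x\<in>V. \<Sum>y\<in>V. s x y) + (\<Sum>x\<in>V. (d x - 18) * (3 * d x - 52)) = 0"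
  proof -
    have "(\<Sum>x\<in>V. \<Sum>y\<in>V. s x y)
        = 7 * (\<Sum>x\<in>V. d x) + (\<Sum>x\<in>V. (36 - d x) * (2 * d x - 26)) - (\<Sum>x\<in>V. d x * d x) + (\<Sum>x\<in>V. d x)"
      using fin unfolding sum_c[symmetric] sum_bd[symmetric]
      by (simp add: s_def sum.distrib sum_subtractf sum_distrib_left[symmetric] d_def)
    also have "\<dots> = - (\<Sum>x\<in>V. (d x - 18) * (3 * d x - 52))"
      unfolding sum_distrib_left sum.distrib[symmetric] sum_subtractf[symmetric] sum_negf[symmetric]
      by (intro sum.cong) (auto simp: algebra_simps)
    finally show ?thesis by simp
  qed
  \<comment> \<open>The roots 52/3 and 18 have no integer strictly between them.\<close>
  have f_nonneg: "(d x - 18) * (3 * d x - 52) \<ge> 0" for x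
    by (cases "d x \<ge> 18") (auto intro: mult_nonneg_nonneg mult_nonpos_nonpos)
  have "(\<Sum>x\<in>V. \<Sum>y\<in>V. s x y) \<ge> 0" by (intro sum_nonneg s_nonneg)
  moreover have "(\<Sum>x\<in>V. (d x - 18) * (3 * d x - 52)) \<ge> 0" by (intro sum_nonneg f_nonneg)
  ultimately have zero: "(\<Sum>x\<in>V. \<Sum>y\<in>V. s x y) = 0" "(\<Sum>x\<in>V. (d x - 18) * (3 * d x - 52)) = 0"
    using total by linarith+
  have d18: "d x = 18" if "x \<in> V" for x
  proof -
    have "(d x - 18) * (3 * d x - 52) = 0"
      using zero(2) that fin f_nonneg by (subst (asm) sum_nonneg_eq_0_iff) auto
    then show ?thesis by simp presburger
  qed
  have s0: "s x y = 0" if "x \<in> V" "y \<in> V" for x y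
  proof -
    have "(\<Sum>y\<in>V. s x y) = 0"
      using zero(1) that s_nonneg fin by (subst (asm) sum_nonneg_eq_0_iff) (auto intro: sum_nonneg)
    then show ?thesis
      using that s_nonneg fin by (subst (asm) sum_nonneg_eq_0_iff) auto
  qed
  show False
  proof (rule no_strongly_regular_37_18_7_10[OF V a_diag a_sym])
    show "(\<Sum>y\<in>V. a x y) = 18" if "x \<in> V" for x
      using d18[OF that] by (simp add: d_def)
    show "(\<Sum>z\<in>V. a x z * a y z) = 10 - 3 * a x y" if "x \<in> V" "y \<in> V" "x \<noteq> y" for x y
      using s0[OF that(1,2)] that by (simp add: s_def b_def d18 c_def)
    show "a x y * a x y = a x y" for x y by (simp add: a_def)
  qed
qed

section \<open>Books and common neighbours\<close>

lemma verts_book_graph: "verts (book_graph t) = {..<t + 2}"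
  by (simp add: book_graph_def)

lemma contains_book_iff:
  assumes F: "simple_graph F"
  shows "contains_copy F (book_graph t) \<longleftrightarrow>
    (\<exists>x y. {x, y} \<in> edges F \<and> t \<le> card {z \<in> verts F. {x, z} \<in> edges F \<and> {y, z} \<in> edges F})"
proof
  assume "contains_copy F (book_graph t)"
  then obtain f where f: "inj_on f {..<t + 2}" "f ` {..<t + 2} \<subseteq> verts F"
    and E: "\<And>e. e \<in> edges (book_graph t) \<Longrightarrow> f ` e \<in> edges F"
    unfolding contains_copy_def by (auto simp only: verts_book_graph)
  have spine: "{f 0, f 1} \<in> edges F"
    using E[of "{0, 1}"] by (simp add: book_graph_def)
  have pages: "{f 0, f i} \<in> edges F" "{f 1, f i} \<in> edges F" if "i \<in> {2..<t + 2}" for i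
    using E[of "{0, i}"] E[of "{1, i}"] that by (auto simp: book_graph_def)
  have "t = card (f ` {2..<t + 2})"
    using f(1) by (subst card_image) (auto elim: inj_on_subset)
  also have "\<dots> \<le> card {z \<in> verts F. {f 0, z} \<in> edges F \<and> {f 1, z} \<in> edges F}"
    using F f(2) pages by (intro card_mono) (auto simp: simple_graph_def)
  finally show "\<exists>x y. {x, y} \<in> edges F \<and> t \<le> card {z \<in> verts F. {x, z} \<in> edges F \<and> {y, z} \<in> edges F}"
    using spine by blast
next
  assume "\<exists>x y. {x, y} \<in> edges F \<and> t \<le> card {z \<in> verts F. {x, z} \<in> edges F \<and> {y, z} \<in> edges F}"
  then obtain x y where xy: "{x, y} \<in> edges F"
    and "t \<le> card {z \<in> verts F. {x, z} \<in> edges F \<and> {y, z} \<in> edges F}" by blast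
  then obtain T where T: "T \<subseteq> {z \<in> verts F. {x, z} \<in> edges F \<and> {y, z} \<in> edges F}"
    "card T = t" "finite T"
    by (meson obtain_subset_with_card_n)
  have edgeD: "u \<in> verts F \<and> v \<in> verts F \<and> u \<noteq> v" if "{u, v} \<in> edges F" for u v
    using that F doubleton_in_nsets_2[of u v "verts F"] unfolding simple_graph_def by blast
  have "card {2..<t + 2} = card T" using T by simp
  then obtain g where g: "bij_betw g {2..<t + 2} T"
    using T(3) by (metis bij_betw_iff_card finite_atLeastLessThan)
  define f where "f i = (if i = 0 then x else if i = 1 then y else g i)" for i :: nat
  have gT: "g i \<in> T" if "i \<in> {2..<t + 2}" for i using g that by (auto simp: bij_betw_def)
  have g_edges: "{x, g i} \<in> edges F" "{y, g i} \<in> edges F" if "i \<in> {2..<t + 2}" for i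
    using gT[OF that] T(1) by auto
  have dom: "{..<t + 2} = {0, 1} \<union> {2..<t + 2}" by auto
  have f_eq: "f 0 = x" "f 1 = y" "\<And>i. i \<in> {2..<t + 2} \<Longrightarrow> f i = g i"
    by (auto simp: f_def)
  have "inj_on f {2..<t + 2}"
    using g f_eq(3) by (auto simp: bij_betw_def inj_on_def)
  moreover have "x \<notin> f ` {2..<t + 2}" "y \<notin> f ` {2..<t + 2}"
    using edgeD[OF g_edges(1)] edgeD[OF g_edges(2)] f_eq(3) by (auto simp: image_iff)
  moreover have "x \<noteq> y" using edgeD[OF xy] by blast
  ultimately have "inj_on f (insert 0 (insert 1 {2..<t + 2}))"
    using f_eq(1,2) by (auto simp: inj_on_insert)
  then have "inj_on f {..<t + 2}" unfolding dom by simp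
  moreover have "f ` {..<t + 2} \<subseteq> verts F"
    unfolding dom using edgeD[OF xy] edgeD[OF g_edges(1)] f_eq by fastforce
  moreover have "f ` e \<in> edges F" if "e \<in> edges (book_graph t)" for e
    using that xy g_edges f_eq by (auto simp: book_graph_def)
  ultimately show "contains_copy F (book_graph t)"
    unfolding contains_copy_def verts_book_graph by blast
qed

lemma simple_graph_complement: "simple_graph F \<Longrightarrow> simple_graph (graph_complement F)"
  by (auto simp: simple_graph_def graph_complement_def)

lemma book_8_or_co_book_10_if_37_verts:
  assumes F: "simple_graph F" and card: "card (verts F) = 37"
  shows "contains_copy F (book_graph 8) \<or> contains_copy (graph_complement F) (book_graph 10)"
proof (rule ccontr)
  assume "\<not> ?thesis"
  then have no: "\<not> contains_copy F (book_graph 8)" "\<not> contains_copy (graph_complement F) (book_graph 10)"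
    by auto
  have edgeD: "u \<in> verts F \<and> v \<in> verts F \<and> u \<noteq> v" if "{u, v} \<in> edges F" for u v
    using that F doubleton_in_nsets_2[of u v "verts F"] unfolding simple_graph_def by blast
  have nonedge: "{u, v} \<in> edges (graph_complement F) \<longleftrightarrow>
      u \<in> verts F \<and> v \<in> verts F \<and> u \<noteq> v \<and> {u, v} \<notin> edges F" for u v
    by (auto simp: graph_complement_def)
  show False
  proof (rule no_37_vertex_graph_with_small_books[of "verts F" "\<lambda>x y. {x, y} \<in> edges F"])
    show "card (verts F) = 37" by (rule card)
    show "{x, x} \<notin> edges F" for x using edgeD[of x x] by auto
    show "{y, x} \<in> edges F" if "{x, y} \<in> edges F" for x y
      using that by (simp add: insert_commute)
    show "card {z \<in> verts F. {x, z} \<in> edges F \<and> {y, z} \<in> edges F} \<le> 7" if "{x, y} \<in> edges F" for x y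
    proof -
      have "\<not> 8 \<le> card {z \<in> verts F. {x, z} \<in> edges F \<and> {y, z} \<in> edges F}"
        using no(1) that unfolding contains_book_iff[OF F] by blast
      then show ?thesis by simp
    qed
    fix x y assume xy: "x \<in> verts F" "y \<in> verts F" "x \<noteq> y" "{x, y} \<notin> edges F"
    have "{z \<in> verts F. z \<noteq> x \<and> z \<noteq> y \<and> {x, z} \<notin> edges F \<and> {y, z} \<notin> edges F} =
        {z \<in> verts (graph_complement F). {x, z} \<in> edges (graph_complement F) \<and> {y, z} \<in> edges (graph_complement F)}"
      unfolding nonedge using xy by (auto simp: graph_complement_def)
    moreover have "\<not> 10 \<le> card \<dots>"
      using no(2) xy nonedge unfolding contains_book_iff[OF simple_graph_complement[OF F]] by blast
    ultimately show "card {z \<in> verts F. z \<noteq> x \<and> z \<noteq> y \<and> {x, z} \<notin> edges F \<and> {y, z} \<notin> edges F} \<le> 9"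
      by simp
  qed
qed

text \<open>
  A graph of bounded codegrees on any finite vertex set yields book-free graphs on sets of
  natural numbers of every order up to its own, by passing to an induced subgraph.
\<close>
lemma book_free_graph_of_smaller_order:
  fixes V :: "'v set" and A :: "'v \<Rightarrow> 'v \<Rightarrow> bool"
  assumes n: "n \<le> card V" and V: "finite V"
    and sym: "\<And>x y. A x y \<Longrightarrow> A y x"
    and adj: "\<And>x y. x \<in> V \<Longrightarrow> y \<in> V \<Longrightarrow> A x y \<Longrightarrow> card {z\<in>V. A x z \<and> A y z} < s"
    and non_adj: "\<And>x y. x \<in> V \<Longrightarrow> y \<in> V \<Longrightarrow> x \<noteq> y \<Longrightarrow> \<not> A x y \<Longrightarrow>
      card {z\<in>V. z \<noteq> x \<and> z \<noteq> y \<and> \<not> A x z \<and> \<not> A y z} < t"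
  shows "\<exists>F :: nat graph. simple_graph F \<and> card (verts F) = n \<and>
    \<not> contains_copy F (book_graph s) \<and> \<not> contains_copy (graph_complement F) (book_graph t)"
proof -
  obtain W where W: "W \<subseteq> V" "card W = n" "finite W"
    using n by (meson obtain_subset_with_card_n)
  then obtain g where g: "bij_betw g {..<n} W"
    by (metis bij_betw_iff_card card_lessThan finite_lessThan)
  have gV: "g i \<in> V" if "i < n" for i using g W that by (auto simp: bij_betw_def)
  have g_inj: "inj_on g {..<n}" using g by (simp add: bij_betw_def)
  have g_eq: "g i = g j \<longleftrightarrow> i = j" if "i < n" "j < n" for i j
    using g_inj that by (auto simp: inj_on_def)
  define F :: "nat graph" where
    "F = ({..<n}, {e. \<exists>i j. e = {i, j} \<and> i < n \<and> j < n \<and> i \<noteq> j \<and> A (g i) (g j)})"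
  have vF: "verts F = {..<n}" "verts (graph_complement F) = {..<n}"
    by (simp_all add: F_def graph_complement_def)
  have edge: "{i, j} \<in> edges F \<longleftrightarrow> i < n \<and> j < n \<and> i \<noteq> j \<and> A (g i) (g j)" for i j
    using sym by (auto simp: F_def doubleton_eq_iff)
  have coedge: "{i, j} \<in> edges (graph_complement F) \<longleftrightarrow> i < n \<and> j < n \<and> i \<noteq> j \<and> \<not> A (g i) (g j)" for i j
    using edge by (auto simp: graph_complement_def vF)
  have F: "simple_graph F" by (auto simp: simple_graph_def F_def)
  have "\<not> contains_copy F (book_graph s)"
  proof
    assume "contains_copy F (book_graph s)"
    then obtain i j where ij: "i < n" "j < n" "i \<noteq> j" "A (g i) (g j)"
      and "s \<le> card {k \<in> {..<n}. {i, k} \<in> edges F \<and> {j, k} \<in> edges F}"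
      unfolding contains_book_iff[OF F] vF edge by blast
    note this(5)
    also have "card {k \<in> {..<n}. {i, k} \<in> edges F \<and> {j, k} \<in> edges F}
        \<le> card {z\<in>V. A (g i) z \<and> A (g j) z}"
      by (rule card_inj_on_le[of g]) (use V gV in \<open>auto simp: edge intro: inj_on_subset[OF g_inj]\<close>)
    also have "\<dots> < s" using adj gV ij by blast
    finally show False by simp
  qed
  moreover have "\<not> contains_copy (graph_complement F) (book_graph t)"
  proof
    assume "contains_copy (graph_complement F) (book_graph t)"
    then obtain i j where ij: "i < n" "j < n" "i \<noteq> j" "\<not> A (g i) (g j)"
      and "t \<le> card {k \<in> {..<n}. {i, k} \<in> edges (graph_complement F) \<and> {j, k} \<in> edges (graph_complement F)}"
      unfolding contains_book_iff[OF simple_graph_complement[OF F]] vF coedge by blast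
    note this(5)
    also have "card {k \<in> {..<n}. {i, k} \<in> edges (graph_complement F) \<and> {j, k} \<in> edges (graph_complement F)}
        \<le> card {z\<in>V. z \<noteq> g i \<and> z \<noteq> g j \<and> \<not> A (g i) z \<and> \<not> A (g j) z}"
      by (rule card_inj_on_le[of g]) (use V gV in \<open>auto simp: coedge g_eq intro: inj_on_subset[OF g_inj]\<close>)
    also have "\<dots> < t" using non_adj gV ij g_eq by blast
    finally show False by simp
  qed
  ultimately show ?thesis using F vF(1) by (intro exI[of _ F]) simp
qed

section \<open>A graph on 36 vertices without the two books\<close>

text \<open>
  The vertices are pairs \<open>(b, i)\<close>, where \<open>b\<close> names one of two blocks and \<open>i\<close> is a residue
  modulo 18 represented in \<open>{0..17}\<close>. The vertices \<open>(b, i)\<close> and \<open>(c, j)\<close> are adjacent iff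
  \<open>j - i\<close> lies in \<open>diff_set b c\<close> modulo 18. The four sets were found by a computer search; they
  satisfy \<open>diff_set c b = - diff_set b c\<close> modulo 18, which makes adjacency symmetric.
\<close>
fun diff_set :: "bool \<Rightarrow> bool \<Rightarrow> int set" where
  "diff_set False False = {1, 2, 6, 7, 9, 11, 12, 16, 17}"
| "diff_set False True = {1, 2, 3, 5, 7, 13, 16, 17}"
| "diff_set True False = {1, 2, 5, 11, 13, 15, 16, 17}"
| "diff_set True True = {3, 4, 5, 8, 10, 13, 14, 15}"

definition bicirculant_adj :: "bool \<times> int \<Rightarrow> bool \<times> int \<Rightarrow> bool" where
  "bicirculant_adj = (\<lambda>(b, i) (c, j). (j - i) mod 18 \<in> diff_set b c)"

definition bicirculant_verts :: "(bool \<times> int) list" where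
  "bicirculant_verts = List.product [False, True] [0..17]"

text \<open>
  The rotation by \<open>- i\<close> of both blocks; it is an automorphism that moves \<open>(b, i)\<close> to \<open>(b, 0)\<close>.
\<close>
definition rotate_to :: "int \<Rightarrow> bool \<times> int \<Rightarrow> bool \<times> int" where
  "rotate_to i = (\<lambda>(c, j). (c, (j - i) mod 18))"

lemma set_bicirculant_verts: "set bicirculant_verts = UNIV \<times> {0..17}"
  by (auto simp: bicirculant_verts_def)

lemma diff_set_uminus: "x mod 18 \<in> diff_set b c \<Longrightarrow> (- x) mod 18 \<in> diff_set c b"
  by (cases b; cases c) (auto simp: zmod_zminus1_eq_if split: if_splits)

lemma bicirculant_adj_sym:
  assumes "bicirculant_adj x y"
  shows "bicirculant_adj y x"
proof -
  obtain b i c j where xy: "x = (b, i)" "y = (c, j)" by (cases x, cases y)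
  show ?thesis
    using assms diff_set_uminus[of "j - i" b c] by (simp add: xy bicirculant_adj_def)
qed

lemma bicirculant_adj_irrefl: "\<not> bicirculant_adj x x"
  by (cases x; cases "fst x") (auto simp: bicirculant_adj_def)

lemma bicirculant_adj_rotate: "bicirculant_adj (rotate_to i x) (rotate_to i y) \<longleftrightarrow> bicirculant_adj x y"
  by (auto simp: bicirculant_adj_def rotate_to_def mod_simps split: prod.splits)

lemma inj_on_rotate_to: "inj_on (rotate_to i) (set bicirculant_verts)"
proof (rule inj_onI, clarsimp simp: set_bicirculant_verts rotate_to_def)
  fix j k :: int
  assume eq: "(j - i) mod 18 = (k - i) mod 18" and bounds: "0 \<le> j" "j \<le> 17" "0 \<le> k" "k \<le> 17"
  from eq have "18 dvd (j - i) - (k - i)" by (simp only: mod_eq_dvd_iff)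
  then have "18 dvd j - k" by simp
  with bounds show "j = k" by presburger
qed

lemma rotate_to_in:
  assumes "x \<in> set bicirculant_verts"
  shows "rotate_to i x \<in> set bicirculant_verts"
  using pos_mod_bound[of 18 "snd x - i"] pos_mod_sign[of 18 "snd x - i"]
  by (cases x) (simp add: set_bicirculant_verts rotate_to_def)

text \<open>
  Common neighbours and common non-neighbours are named predicates, so that the evaluation below
  applies them to concrete vertices only and never simplifies under a binder.
\<close>
definition common_nbr :: "bool \<times> int \<Rightarrow> bool \<times> int \<Rightarrow> bool \<times> int \<Rightarrow> bool" where
  "common_nbr x y z \<longleftrightarrow> bicirculant_adj x z \<and> bicirculant_adj y z"

definition common_non_nbr :: "bool \<times> int \<Rightarrow> bool \<times> int \<Rightarrow> bool \<times> int \<Rightarrow> bool" where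
  "common_non_nbr x y z \<longleftrightarrow> z \<noteq> x \<and> z \<noteq> y \<and> \<not> bicirculant_adj x z \<and> \<not> bicirculant_adj y z"

text \<open>
  The pair \<open>x\<close>, \<open>y\<close> is the spine of neither a book with 8 pages nor, in the complement, a book
  with 10 pages.
\<close>
definition codegree_ok :: "bool \<times> int \<Rightarrow> bool \<times> int \<Rightarrow> bool" where
  "codegree_ok x y \<longleftrightarrow> x = y \<or>
     (if bicirculant_adj x y then length (filter (common_nbr x y) bicirculant_verts) < 8
      else length (filter (common_non_nbr x y) bicirculant_verts) < 10)"

text \<open>
  These pairs suffice, because each pair of vertices is a rotation of one of them.
\<close>
lemma codegree_ok_base:
  "list_all (codegree_ok (False, 0)) bicirculant_verts"
  "list_all (codegree_ok (True, 0)) bicirculant_verts"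
  by code_simp+

lemma no_book_8_and_no_co_book_10_if_le_36_verts:
  assumes "n \<le> 36"
  shows "\<exists>F :: nat graph. simple_graph F \<and> card (verts F) = n \<and>
    \<not> contains_copy F (book_graph 8) \<and> \<not> contains_copy (graph_complement F) (book_graph 10)"
proof (rule book_free_graph_of_smaller_order[OF _ _ bicirculant_adj_sym])
  let ?V = "set bicirculant_verts"
  show "n \<le> card ?V" using assms by (simp add: set_bicirculant_verts card_cartesian_product)
  have card_rotate: "card {z\<in>?V. P z} < m"
    if le: "length (filter Q bicirculant_verts) < m"
      and PQ: "\<And>z. z \<in> ?V \<Longrightarrow> P z \<Longrightarrow> Q (rotate_to i z)" for P Q i m
  proof -
    have "card {z\<in>?V. P z} \<le> card (set (filter Q bicirculant_verts))"
      by (rule card_inj_on_le[of "rotate_to i"])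
        (use PQ rotate_to_in in \<open>auto intro: inj_on_subset[OF inj_on_rotate_to]\<close>)
    also have "\<dots> \<le> length (filter Q bicirculant_verts)" by (rule card_length)
    finally show ?thesis using le by simp
  qed
  have rotate_eq: "rotate_to i x = rotate_to i y \<longleftrightarrow> x = y" if "x \<in> ?V" "y \<in> ?V" for i x y
    using inj_on_rotate_to that by (auto simp: inj_on_def)
  fix x y assume xy: "x \<in> ?V" "y \<in> ?V"
  obtain b i where x: "x = (b, i)" by (cases x)
  have x0: "rotate_to i x = (b, 0)" by (simp add: rotate_to_def x)
  have adj0: "bicirculant_adj (b, 0) (rotate_to i y) \<longleftrightarrow> bicirculant_adj x y"
    using bicirculant_adj_rotate[of i x y] by (simp add: x0)
  have eq0: "(b, 0) = rotate_to i y \<longleftrightarrow> x = y"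
    using rotate_eq[OF xy, of i] by (simp add: x0)
  have check: "codegree_ok (b, 0) (rotate_to i y)"
    using codegree_ok_base rotate_to_in[OF xy(2), of i] unfolding list_all_iff by (cases b) auto
  show "card {z \<in> ?V. bicirculant_adj x z \<and> bicirculant_adj y z} < 8" if adj: "bicirculant_adj x y"
  proof (rule card_rotate)
    have "x \<noteq> y" using adj bicirculant_adj_irrefl by blast
    then show "length (filter (common_nbr (b, 0) (rotate_to i y)) bicirculant_verts) < 8"
      using check adj by (simp add: codegree_ok_def adj0 eq0)
    show "common_nbr (b, 0) (rotate_to i y) (rotate_to i z)"
      if "bicirculant_adj x z \<and> bicirculant_adj y z" for z
      using that by (simp add: common_nbr_def x0[symmetric] bicirculant_adj_rotate)
  qed
  show "card {z \<in> ?V. z \<noteq> x \<and> z \<noteq> y \<and> \<not> bicirculant_adj x z \<and> \<not> bicirculant_adj y z} < 10"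
    if non_adj: "x \<noteq> y" "\<not> bicirculant_adj x y"
  proof (rule card_rotate)
    show "length (filter (common_non_nbr (b, 0) (rotate_to i y)) bicirculant_verts) < 10"
      using check non_adj by (simp add: codegree_ok_def adj0 eq0)
    show "common_non_nbr (b, 0) (rotate_to i y) (rotate_to i z)"
      if "z \<in> ?V" "z \<noteq> x \<and> z \<noteq> y \<and> \<not> bicirculant_adj x z \<and> \<not> bicirculant_adj y z" for z
      using that xy by (simp add: common_non_nbr_def x0[symmetric] bicirculant_adj_rotate rotate_eq)
  qed
qed simp

theorem theorem1:
  shows "ramsey_number (book_graph 8) (book_graph 10) = 37"
  unfolding ramsey_number_def
proof (rule Least_equality)
  show "\<forall>F :: nat graph. simple_graph F \<and> card (verts F) = 37 \<longrightarrow>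
      contains_copy F (book_graph 8) \<or> contains_copy (graph_complement F) (book_graph 10)"
    using book_8_or_co_book_10_if_37_verts by blast
next
  fix n
  assume n: "\<forall>F :: nat graph. simple_graph F \<and> card (verts F) = n \<longrightarrow>
      contains_copy F (book_graph 8) \<or> contains_copy (graph_complement F) (book_graph 10)"
  show "37 \<le> n"
  proof (rule ccontr)
    assume "\<not> 37 \<le> n"
    then have "n \<le> 36" by simp
    from no_book_8_and_no_co_book_10_if_le_36_verts[OF this] n show False by blast
  qed
qed

end
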